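(* Let $(S,+)$ be an abelian semigroup, let $k\in\mathbb{N}$, and let $A_1,\dots,A_k\subseteq S$ be covered by $\mathbb{N}$-konvex subsets of $S$ (that is, each $A_i$ is contained in some $\mathbb{N}$-konvex subset of $S$). Then $$\mathrm{conv}_{\mathbb{N}}(A_1\cup\cdots\cup A_k)=\bigcup\big\{\mathrm{conv}_{\mathbb{N}}(\{a_1,\dots,a_k\})\mid a_1\in\mathrm{conv}_{\mathbb{N}}(A_1),\,\dots,\,a_k\in\mathrm{conv}_{\mathbb{N}}(A_k)\big\}.$$
   Context: $\mathbb{N}$ denotes the set of positive integers, and an abelian semigroup is a set with a commutative associative operation $+$. For $n\in\mathbb{N}$ and $x\in S$, $nx:=x+\cdots+x$ ($n$ summands). For $A\subseteq S$ and $n\in\mathbb{N}$ put $nA:=\{nx\mid x\in A\}$, $n^{-1}A:=\{x\in S\mid nx\in A\}$, $[n]A:=\{x_1+\cdots+x_n\mid x_1,\ldots,x_n\in A\}$. A set $A\subseteq S$ is $n$-convex if $n^{-1}([n]A)\subseteq A$, and $n$-konvex if $[n]A\subseteq nA$. It is $\mathbb{N}$-convex (respectively $\mathbb{N}$-konvex) if it is $n$-convex (respectively $n$-konvex) for all $n\in\mathbb{N}$. The $\mathbb{N}$-convex hull of $A\subseteq S$ is $\mathrm{conv}_{\mathbb{N}}(A):=\bigcap\{C\mid A\subseteq C\subseteq S,\ C\text{ is }\mathbb{N}\text{-convex}\}$.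
   Formalization: The sets A_1,…,A_k are additionally assumed to be either all nonempty or all empty; if only some are empty the equality fails, since the right side is empty while the left side contains the nonempty A_i. *)

theory Defs
  imports Main
begin

(* Sum of a nonempty list; a semigroup need not have a zero, so sum_list is not available.
   The value on the empty list is unspecified and is never used below, as every n is positive. *)
fun ssum :: "'a::ab_semigroup_add list \<Rightarrow> 'a" where
  "ssum [] = undefined"
| "ssum [x] = x"
| "ssum (x # y # xs) = x + ssum (y # xs)"

definition nmul :: "nat \<Rightarrow> 'a::ab_semigroup_add \<Rightarrow> 'a" where
  "nmul n x = ssum (replicate n x)"

definition scale_set :: "nat \<Rightarrow> 'a::ab_semigroup_add set \<Rightarrow> 'a set" where
  "scale_set n A = nmul n ` A"

definition div_set :: "nat \<Rightarrow> 'a::ab_semigroup_add set \<Rightarrow> 'a set" where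
  "div_set n A = {x. nmul n x \<in> A}"

definition sumset :: "nat \<Rightarrow> 'a::ab_semigroup_add set \<Rightarrow> 'a set" where
  "sumset n A = {ssum xs | xs. length xs = n \<and> set xs \<subseteq> A}"

definition n_convex :: "nat \<Rightarrow> 'a::ab_semigroup_add set \<Rightarrow> bool" where
  "n_convex n A \<longleftrightarrow> div_set n (sumset n A) \<subseteq> A"

definition n_konvex :: "nat \<Rightarrow> 'a::ab_semigroup_add set \<Rightarrow> bool" where
  "n_konvex n A \<longleftrightarrow> sumset n A \<subseteq> scale_set n A"

definition nat_convex :: "'a::ab_semigroup_add set \<Rightarrow> bool" where
  "nat_convex A \<longleftrightarrow> (\<forall>n\<ge>1. n_convex n A)"

definition nat_konvex :: "'a::ab_semigroup_add set \<Rightarrow> bool" where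
  "nat_konvex A \<longleftrightarrow> (\<forall>n\<ge>1. n_konvex n A)"

definition nat_conv :: "'a::ab_semigroup_add set \<Rightarrow> 'a set" where
  "nat_conv A = \<Inter>{C. A \<subseteq> C \<and> nat_convex C}"

end

theory Submission
  imports Defs
begin

text \<open>
  The hull has the explicit description
  \<open>nat_conv A = {x. \<exists>n\<ge>1. nmul n x \<in> sumset n A}\<close> (\<open>nat_conv_eq\<close>): rational convex
  combinations with the denominator cleared. The right-hand side is \<open>\<nat>\<close>-convex because the
  multipliers of finitely many points can be replaced by a common one.

  Let \<open>x\<close> lie in the hull of the union, so that \<open>nmul n x\<close> is a sum of \<open>n\<close> elements of the
  \<open>A i\<close>. Collect the summands from each \<open>A i\<close>, say \<open>m\<close> of them with sum \<open>s\<close>. If \<open>m \<ge> 1\<close>,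
  konvexity of the set covering \<open>A i\<close> yields \<open>b\<close> with \<open>s = nmul m b\<close>, and by the description
  of the hull \<open>b\<close> lies in \<open>nat_conv (A i)\<close>. Hence these summands may all be replaced by \<open>b\<close>
  without changing the total; if \<open>m = 0\<close>, any element of \<open>A i\<close> serves as \<open>b\<close>. The total is now
  a sum of \<open>n\<close> elements of \<open>{a 1, \<dots>, a k}\<close>, which places \<open>x\<close> in the hull of this set. As a
  semigroup has no empty sum, \<open>sumset_UN_replace\<close> carries this out one set at a time, with
  \<open>sumset_Un_cases\<close> separating the summands of that set from the others.

  The reverse inclusion only uses that \<open>nat_conv\<close> is a closure operator. If all \<open>A i\<close> are
  empty, so are both sides: the hull of \<open>{}\<close> is empty, and no family \<open>a\<close> exists as \<open>k \<ge> 1\<close>.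
\<close>

section \<open>Sums and multiples in a semigroup\<close>

lemma ssum_Cons: "length xs \<ge> 1 \<Longrightarrow> ssum (x # xs) = x + ssum xs"
  by (cases xs) auto

lemma nmul_1 [simp]: "nmul (Suc 0) x = x"
  by (simp add: nmul_def)

lemma nmul_Suc: "n \<ge> 1 \<Longrightarrow> nmul (Suc n) x = x + nmul n x"
  by (cases n) (simp_all add: nmul_def)

lemma nmul_add_left:
  assumes "m \<ge> 1" "n \<ge> 1"
  shows "nmul (m + n) x = nmul m x + nmul n x"
  using assms(1)
proof (induction m rule: dec_induct)
  case base
  show ?case using assms(2) by (simp add: nmul_Suc)
next
  case (step m)
  then show ?case by (simp add: nmul_Suc add.assoc)
qed

lemma nmul_add_right:
  assumes "n \<ge> 1"
  shows "nmul n (x + y) = nmul n x + nmul n y"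
  using assms
  by (induction n rule: dec_induct) (simp_all add: nmul_Suc ac_simps)

lemma nmul_nmul:
  assumes "m \<ge> 1" "n \<ge> 1"
  shows "nmul m (nmul n x) = nmul (m * n) x"
  using assms(1)
proof (induction m rule: dec_induct)
  case base
  show ?case by simp
next
  case (step m)
  then show ?case using assms(2) by (simp add: nmul_Suc nmul_add_left)
qed

lemma sumset_1 [simp]: "sumset (Suc 0) A = A"
proof
  show "sumset (Suc 0) A \<subseteq> A"
    by (auto simp: sumset_def length_Suc_conv)
  show "A \<subseteq> sumset (Suc 0) A"
  proof
    fix x assume "x \<in> A"
    then have "length [x] = Suc 0 \<and> set [x] \<subseteq> A \<and> x = ssum [x]" by simp
    then show "x \<in> sumset (Suc 0) A" unfolding sumset_def by blast
  qed
qed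

lemma sumset_SucE:
  assumes "s \<in> sumset (Suc n) A" "n \<ge> 1"
  obtains a t where "a \<in> A" "t \<in> sumset n A" "s = a + t"
proof -
  from assms(1) obtain a xs where "s = ssum (a # xs)" "length xs = n" "set (a # xs) \<subseteq> A"
    unfolding sumset_def by (auto simp: length_Suc_conv)
  moreover from this have "s = a + ssum xs" "a \<in> A" using assms(2) by (simp_all add: ssum_Cons)
  moreover have "ssum xs \<in> sumset n A" using calculation unfolding sumset_def by auto
  ultimately show ?thesis using that by blast
qed

lemma sumset_SucI:
  assumes "n \<ge> 1" "a \<in> A" "t \<in> sumset n A"
  shows "a + t \<in> sumset (Suc n) A"
proof -
  from assms(3) obtain xs where xs: "t = ssum xs" "length xs = n" "set xs \<subseteq> A"
    unfolding sumset_def by auto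
  then have "a + t = ssum (a # xs)" using assms(1) by (auto simp: ssum_Cons)
  moreover have "length (a # xs) = Suc n" "set (a # xs) \<subseteq> A" using xs assms(2) by auto
  ultimately show ?thesis unfolding sumset_def by blast
qed

lemma sumset_mono: "A \<subseteq> B \<Longrightarrow> sumset n A \<subseteq> sumset n B"
  by (auto simp: sumset_def)

lemma sumset_empty: "n \<ge> 1 \<Longrightarrow> sumset n {} = {}"
  by (auto simp: sumset_def)

lemma nmul_mem_sumset: "x \<in> A \<Longrightarrow> nmul n x \<in> sumset n A"
  by (auto simp: sumset_def nmul_def intro!: exI[of _ "replicate n x"])

lemma sumset_add:
  assumes "m \<ge> 1" "n \<ge> 1" "s \<in> sumset m A" "t \<in> sumset n A"
  shows "s + t \<in> sumset (m + n) A"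
  using assms(1,3)
proof (induction m arbitrary: s rule: dec_induct)
  case base
  then show ?case using assms(2,4) by (simp add: sumset_SucI)
next
  case (step m)
  from step.prems step.hyps obtain a u where "a \<in> A" "u \<in> sumset m A" "s = a + u"
    by (auto elim: sumset_SucE)
  with step show ?case by (simp add: sumset_SucI add.assoc)
qed

lemma nmul_sumset:
  assumes "m \<ge> 1" "n \<ge> 1" "s \<in> sumset n A"
  shows "nmul m s \<in> sumset (m * n) A"
  using assms(1)
proof (induction m rule: dec_induct)
  case base
  show ?case using assms(3) by simp
next
  case (step m)
  then show ?case using assms(2,3) by (simp add: nmul_Suc sumset_add)
qed

text \<open>Commutativity lets the summands from \<open>A\<close> be moved to the front. Three cases occur since
  there is no neutral element to stand for an empty partial sum.\<close>

lemma sumset_Un_cases: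
  assumes "n \<ge> 1" "s \<in> sumset n (A \<union> B)"
  obtains "s \<in> sumset n A"
  | "s \<in> sumset n B"
  | p q t u where "p \<ge> 1" "q \<ge> 1" "p + q = n" "t \<in> sumset p A" "u \<in> sumset q B" "s = t + u"
proof -
  have "s \<in> sumset n A \<or> s \<in> sumset n B \<or>
      (\<exists>p q t u. p \<ge> 1 \<and> q \<ge> 1 \<and> p + q = n \<and> t \<in> sumset p A \<and> u \<in> sumset q B \<and> s = t + u)"
    using assms
  proof (induction n arbitrary: s rule: dec_induct)
    case base
    then show ?case by auto
  next
    case (step n)
    from step.prems step.hyps(1) obtain c r
      where c: "c \<in> A \<union> B" and r: "r \<in> sumset n (A \<union> B)" and s: "s = c + r"
      by (rule sumset_SucE)
    have one: "Suc 0 \<le> n" using step.hyps by simp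
    from step.IH[OF r] consider "r \<in> sumset n A" | "r \<in> sumset n B"
      | p q t u where "p \<ge> 1" "q \<ge> 1" "p + q = n" "t \<in> sumset p A" "u \<in> sumset q B" "r = t + u"
      by blast
    then show ?case
    proof cases
      case 1
      show ?thesis
      proof (cases "c \<in> A")
        case True
        then show ?thesis using 1 s one by (simp add: sumset_SucI)
      next
        case False
        then have "c \<in> sumset 1 B" using c by simp
        moreover have "s = r + c" using s by (simp add: add.commute)
        moreover have "n + 1 = Suc n" "n \<ge> 1" "(1::nat) \<ge> 1" using one by auto
        ultimately show ?thesis using 1 by blast
      qed
    next
      case 2
      show ?thesis
      proof (cases "c \<in> B")
        case True
        then show ?thesis using 2 s one by (simp add: sumset_SucI)
      next
        case False
        then have "c \<in> sumset 1 A" using c by simp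
        moreover have "1 + n = Suc n" "n \<ge> 1" "(1::nat) \<ge> 1" using one by auto
        ultimately show ?thesis using 2 s by blast
      qed
    next
      case 3
      show ?thesis
      proof (cases "c \<in> A")
        case True
        then have "c + t \<in> sumset (Suc p) A" using 3 by (simp add: sumset_SucI)
        moreover have "s = (c + t) + u" using s 3 by (simp add: ac_simps)
        moreover have "Suc p + q = Suc n" "Suc p \<ge> 1" using 3 by auto
        ultimately show ?thesis using 3 by blast
      next
        case False
        then have "c + u \<in> sumset (Suc q) B" using 3 c by (simp add: sumset_SucI)
        moreover have "s = t + (c + u)" using s 3 by (simp add: ac_simps)
        moreover have "p + Suc q = Suc n" "Suc q \<ge> 1" using 3 by auto
        ultimately show ?thesis using 3 by blast
      qed
    qed
  qed
  then show ?thesis using that by blast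
qed

section \<open>An explicit description of the hull\<close>

lemma nat_convexD:
  "nat_convex C \<Longrightarrow> n \<ge> 1 \<Longrightarrow> nmul n x \<in> sumset n C \<Longrightarrow> x \<in> C"
  unfolding nat_convex_def n_convex_def div_set_def by blast

lemma subset_nat_conv: "A \<subseteq> nat_conv A"
  unfolding nat_conv_def by blast

lemma nat_conv_minimal: "A \<subseteq> C \<Longrightarrow> nat_convex C \<Longrightarrow> nat_conv A \<subseteq> C"
  unfolding nat_conv_def by blast

lemma nat_conv_mono: "A \<subseteq> B \<Longrightarrow> nat_conv A \<subseteq> nat_conv B"
  unfolding nat_conv_def by blast

lemma nat_convex_nat_conv: "nat_convex (nat_conv A)"
proof -
  have "x \<in> C" if "n \<ge> 1" "nmul n x \<in> sumset n (nat_conv A)" "A \<subseteq> C" "nat_convex C" for n x C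
    using that nat_conv_minimal[of A C] sumset_mono[of "nat_conv A" C n]
    by (blast intro: nat_convexD)
  then show ?thesis
    unfolding nat_convex_def n_convex_def div_set_def nat_conv_def[of A] by blast
qed

text \<open>If the first summand becomes a sum of elements of \<open>A\<close> after multiplication by \<open>M\<close>, and
  the remaining sum after multiplication by \<open>N\<close>, then the total does so after multiplication
  by \<open>N * M\<close>.\<close>

lemma sumset_common_multiplier:
  assumes "n \<ge> 1" "s \<in> sumset n {x. \<exists>m\<ge>1. nmul m x \<in> sumset m A}"
  shows "\<exists>N\<ge>1. nmul N s \<in> sumset (N * n) A"
  using assms
proof (induction n arbitrary: s rule: dec_induct)
  case base
  then show ?case by auto
next
  case (step n)
  from step.prems step.hyps obtain h t M
    where t: "t \<in> sumset n {x. \<exists>m\<ge>1. nmul m x \<in> sumset m A}" and s: "s = h + t"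
      and M: "M \<ge> 1" "nmul M h \<in> sumset M A"
    by (auto elim: sumset_SucE)
  from step.IH[OF t] obtain N where N: "N \<ge> 1" "nmul N t \<in> sumset (N * n) A" by blast
  have n: "n \<ge> 1" "N * n \<ge> 1" using N step.hyps by auto
  have "nmul (N * M) s = nmul N (nmul M h) + nmul M (nmul N t)"
    using M N by (simp add: s nmul_add_right nmul_nmul mult.commute)
  also have "\<dots> \<in> sumset (N * M + M * (N * n)) A"
  proof (rule sumset_add)
    show "N * M \<ge> 1" "M * (N * n) \<ge> 1" using M N n by auto
    show "nmul N (nmul M h) \<in> sumset (N * M) A" using M N by (simp add: nmul_sumset)
    show "nmul M (nmul N t) \<in> sumset (M * (N * n)) A" using nmul_sumset[OF M(1) n(2) N(2)] .
  qed
  also have "N * M + M * (N * n) = (N * M) * Suc n" by (simp add: algebra_simps)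
  finally show ?case using M N by (intro exI[of _ "N * M"]) simp
qed

lemma nat_conv_eq: "nat_conv A = {x. \<exists>n\<ge>1. nmul n x \<in> sumset n A}" (is "_ = ?H")
proof
  have "x \<in> ?H" if n: "n \<ge> 1" "nmul n x \<in> sumset n ?H" for n x
  proof -
    from sumset_common_multiplier[OF n] obtain N
      where N: "N \<ge> 1" "nmul N (nmul n x) \<in> sumset (N * n) A" by blast
    then have "nmul (N * n) x \<in> sumset (N * n) A" using n by (simp add: nmul_nmul)
    moreover have "N * n \<ge> 1" using N n by simp
    ultimately show ?thesis by blast
  qed
  then have "nat_convex ?H"
    unfolding nat_convex_def n_convex_def div_set_def by blast
  moreover have "A \<subseteq> ?H" by (auto intro: exI[of _ "Suc 0"])
  ultimately show "nat_conv A \<subseteq> ?H" by (intro nat_conv_minimal)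
  show "?H \<subseteq> nat_conv A"
    using subset_nat_conv[of A] sumset_mono[of A "nat_conv A"] nat_convex_nat_conv
    by (blast intro: nat_convexD)
qed

lemma nat_conv_empty: "nat_conv {} = {}"
  by (auto simp: nat_conv_eq sumset_empty)

section \<open>Replacing summands by multiples of a single hull point\<close>

text \<open>Konvexity of the covering set supplies a point \<open>b\<close> of that set whose \<open>n\<close>-fold multiple
  is the given sum; the explicit description then places \<open>b\<close> in the hull of \<open>A\<close> itself.\<close>

lemma sumset_eq_nmul:
  assumes "nat_konvex K" "A \<subseteq> K" "n \<ge> 1" "s \<in> sumset n A"
  obtains b where "b \<in> nat_conv A" "s = nmul n b"
proof -
  have "s \<in> scale_set n K"
    using assms sumset_mono[of A K n] unfolding nat_konvex_def n_konvex_def by blast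
  then obtain b where b: "s = nmul n b" unfolding scale_set_def by blast
  then have "b \<in> nat_conv A" using assms(3,4) by (auto simp: nat_conv_eq)
  then show ?thesis using b that by blast
qed

lemma sumset_UN_replace:
  assumes "finite I" "I \<noteq> {}" "n \<ge> 1"
    and "\<And>i. i \<in> I \<Longrightarrow> \<exists>K. nat_konvex K \<and> A i \<subseteq> K"
    and "\<And>i. i \<in> I \<Longrightarrow> A i \<noteq> {}"
    and "s \<in> sumset n (\<Union>i\<in>I. A i)"
  shows "\<exists>a. (\<forall>i\<in>I. a i \<in> nat_conv (A i)) \<and> s \<in> sumset n (a ` I)"
  using assms
proof (induction I arbitrary: n s rule: finite_ne_induct)
  case (singleton i)
  then obtain K where "nat_konvex K" "A i \<subseteq> K" by blast
  moreover have "s \<in> sumset n (A i)" using singleton by simp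
  ultimately obtain b where "b \<in> nat_conv (A i)" "s = nmul n b"
    using singleton(1) by (auto elim: sumset_eq_nmul)
  then show ?case by (intro exI[of _ "\<lambda>_. b"]) (simp add: nmul_mem_sumset)
next
  case (insert i I)
  from insert.prems obtain K where K: "nat_konvex K" "A i \<subseteq> K" by blast
  have IH: "\<exists>a. (\<forall>j\<in>I. a j \<in> nat_conv (A j)) \<and> u \<in> sumset q (a ` I)"
    if "q \<ge> 1" "u \<in> sumset q (\<Union>j\<in>I. A j)" for q u
    using insert.IH[OF that(1)] insert.prems that by blast
  \<comment> \<open>A family on \<open>I\<close> and a point for \<open>i\<close> combine to a family on \<open>insert i I\<close>.\<close>
  have extend: "\<exists>a. (\<forall>j\<in>insert i I. a j \<in> nat_conv (A j)) \<and> s \<in> sumset n (a ` insert i I)"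
    if "b \<in> nat_conv (A i)" "\<forall>j\<in>I. a j \<in> nat_conv (A j)" "s \<in> sumset n (insert b (a ` I))"
    for a b
  proof (intro exI conjI)
    have "(a(i := b)) ` insert i I = insert b (a ` I)" using insert.hyps by auto
    then show "s \<in> sumset n ((a(i := b)) ` insert i I)" using that(3) by simp
    show "\<forall>j\<in>insert i I. (a(i := b)) j \<in> nat_conv (A j)" using that by auto
  qed
  have s: "s \<in> sumset n (A i \<union> (\<Union>j\<in>I. A j))" using insert.prems by simp
  from insert.prems(1) s show ?case
  proof (cases rule: sumset_Un_cases)
    case 1
    with K insert.prems(1) obtain b where b: "b \<in> nat_conv (A i)" "s = nmul n b"
      by (auto elim: sumset_eq_nmul)
    have "\<forall>j\<in>I. \<exists>c. c \<in> nat_conv (A j)"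
      using insert.prems(3) subset_nat_conv by blast
    then obtain a where "\<forall>j\<in>I. a j \<in> nat_conv (A j)" by metis
    moreover have "s \<in> sumset n (insert b (a ` I))"
      unfolding b(2) by (intro nmul_mem_sumset insertI1)
    ultimately show ?thesis using b(1) extend by blast
  next
    case 2
    with IH insert.prems(1) obtain a
      where a: "\<forall>j\<in>I. a j \<in> nat_conv (A j)" "s \<in> sumset n (a ` I)" by blast
    obtain b where "b \<in> nat_conv (A i)" using insert.prems(3) subset_nat_conv by blast
    moreover have "s \<in> sumset n (insert b (a ` I))"
      using a(2) sumset_mono[of "a ` I" "insert b (a ` I)"] by blast
    ultimately show ?thesis using a(1) extend by blast
  next
    case (3 p q t u)
    from K 3 obtain b where b: "b \<in> nat_conv (A i)" "t = nmul p b"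
      by (auto elim: sumset_eq_nmul)
    from IH 3 obtain a where a: "\<forall>j\<in>I. a j \<in> nat_conv (A j)" "u \<in> sumset q (a ` I)" by blast
    have "t \<in> sumset p (insert b (a ` I))" by (simp add: b nmul_mem_sumset)
    moreover have "u \<in> sumset q (insert b (a ` I))"
      using a(2) sumset_mono[of "a ` I" "insert b (a ` I)"] by blast
    ultimately have "s \<in> sumset n (insert b (a ` I))"
      using sumset_add[OF 3(1,2)] 3(3,6) by metis
    then show ?thesis using a(1) b(1) extend by blast
  qed
qed

section \<open>The hull of a finite union\<close>

theorem corollary10:
  fixes A :: "nat \<Rightarrow> 'a::ab_semigroup_add set" and k :: nat
  assumes "k \<ge> 1"
    and "\<And>i. i \<in> {1..k} \<Longrightarrow> \<exists>K. nat_konvex K \<and> A i \<subseteq> K"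
    and "(\<forall>i\<in>{1..k}. A i \<noteq> {}) \<or> (\<forall>i\<in>{1..k}. A i = {})"
  shows "nat_conv (\<Union>i\<in>{1..k}. A i) =
    \<Union>{nat_conv (a ` {1..k}) | a. \<forall>i\<in>{1..k}. a i \<in> nat_conv (A i)}"
proof
  let ?R = "\<Union>{nat_conv (a ` {1..k}) | a. \<forall>i\<in>{1..k}. a i \<in> nat_conv (A i)}"
  show "nat_conv (\<Union>i\<in>{1..k}. A i) \<subseteq> ?R"
    using assms(3)
  proof
    assume "\<forall>i\<in>{1..k}. A i = {}"
    then have "(\<Union>i\<in>{1..k}. A i) = {}" by blast
    then show ?thesis by (simp only: nat_conv_empty empty_subsetI)
  next
    assume ne: "\<forall>i\<in>{1..k}. A i \<noteq> {}"
    show ?thesis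
    proof
      fix x assume "x \<in> nat_conv (\<Union>i\<in>{1..k}. A i)"
      then obtain n where n: "n \<ge> 1" "nmul n x \<in> sumset n (\<Union>i\<in>{1..k}. A i)"
        by (auto simp: nat_conv_eq)
      have "\<exists>a. (\<forall>i\<in>{1..k}. a i \<in> nat_conv (A i)) \<and> nmul n x \<in> sumset n (a ` {1..k})"
      proof (rule sumset_UN_replace)
        show "{1..k} \<noteq> {}" using assms(1) by simp
        show "A i \<noteq> {}" if "i \<in> {1..k}" for i using ne that by (rule bspec)
      qed (use n assms(2) in simp_all)
      then obtain a where a: "\<forall>i\<in>{1..k}. a i \<in> nat_conv (A i)"
        and "nmul n x \<in> sumset n (a ` {1..k})" by (elim exE conjE)
      then have "x \<in> nat_conv (a ` {1..k})" using n(1) by (auto simp: nat_conv_eq)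
      then show "x \<in> ?R" using a by blast
    qed
  qed
  have "nat_conv (a ` {1..k}) \<subseteq> nat_conv (\<Union>i\<in>{1..k}. A i)"
    if "\<forall>i\<in>{1..k}. a i \<in> nat_conv (A i)" for a
  proof (rule nat_conv_minimal[OF _ nat_convex_nat_conv])
    have "nat_conv (A i) \<subseteq> nat_conv (\<Union>i\<in>{1..k}. A i)" if "i \<in> {1..k}" for i
      by (intro nat_conv_mono) (use that in blast)
    then show "a ` {1..k} \<subseteq> nat_conv (\<Union>i\<in>{1..k}. A i)" using that by blast
  qed
  then show "?R \<subseteq> nat_conv (\<Union>i\<in>{1..k}. A i)" by blast
qed

end
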